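(* Up to equivalence there is a unique cell system on $\mathcal{E}^{(8)}$, given by $$W_{i_l,j_l,j_{l-1}}=\sqrt{[2][3]},\qquad W_{j_l,j_{l-1},j_{l-2}}=\frac{[2]\sqrt{[3]}}{\sqrt{[4]}},\qquad l=1,\ldots,6,$$ $$W_{j_1,j_3,j_5}=\frac{[2][3]}{\sqrt{[4]}},\qquad W_{j_2,j_4,j_6}=-\frac{[2][3]}{\sqrt{[4]}}.$$
   Context: Let $q=e^{\pi i/8}$ and $[m]=(q^m-q^{-m})/(q-q^{-1})$. The graph $\mathcal{E}^{(8)}$ has vertices $i_l,j_l$, $l=1,\ldots,6$ (indices mod 6), and for each $l$ exactly one edge $i_l\to j_l$, $j_l\to i_{l+1}$, $j_l\to j_{l-1}$, $j_l\to j_{l+2}$. Its Perron-Frobenius eigenvector (eigenvalue $[3]$) is $\phi_{i_l}=1$, $\phi_{j_l}=[3]$. $W_{a,b,c}$ denotes the value of $W$ on the triangle $a\to b\to c\to a$. Cell systems: let $\mathcal{G}$ be a directed graph (loops and multiple edges allowed), with source and range maps $s,r$, Perron-Frobenius eigenvalue $[3]$ and positive Perron-Frobenius eigenvector $(\phi_i)$. A triangle $\triangle_{ijk}^{(\alpha\beta\gamma)}$ is a closed path $i\xrightarrow{\alpha}j\xrightarrow{\beta}k\xrightarrow{\gamma}i$, considered up to cyclic rotation. A cell system $W$ assigns to each triangle a complex number $W(\triangle_{ijk}^{(\alpha\beta\gamma)})$ such that: (I) for all edges $\alpha,\alpha'$ from $i$ to $j$, $\sum_{k,\beta,\gamma}W(\triangle_{ijk}^{(\alpha\beta\gamma)})\overline{W(\triangle_{ijk}^{(\alpha'\beta\gamma)})}=\delta_{\alpha,\alpha'}[2]\phi_i\phi_j$,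 the sum being over vertices $k$ and edges $\beta:j\to k$, $\gamma:k\to i$; (II) for all edges $\alpha_1,\dots,\alpha_4$ with $s(\alpha_1)=s(\alpha_4)=i_1$, $r(\alpha_1)=r(\alpha_2)=i_2$, $s(\alpha_2)=s(\alpha_3)=i_3$, $r(\alpha_3)=r(\alpha_4)=i_4$ (here $i_1,\dots,i_4$ are arbitrary vertices of $\mathcal{G}$), $$\sum\phi_k^{-1}W(\triangle_{i_1i_2k}^{(\alpha_1\beta_1\beta_2)})\overline{W(\triangle_{i_3i_2k}^{(\alpha_2\beta_1\beta_3)})}W(\triangle_{i_3i_4k}^{(\alpha_3\beta_4\beta_3)})\overline{W(\triangle_{i_1i_4k}^{(\alpha_4\beta_4\beta_2)})}=\delta_{\alpha_1,\alpha_4}\delta_{\alpha_2,\alpha_3}\phi_{i_1}\phi_{i_2}\phi_{i_3}+\delta_{\alpha_1,\alpha_2}\delta_{\alpha_3,\alpha_4}\phi_{i_1}\phi_{i_2}\phi_{i_4},$$ the sum being over vertices $k$ and edges $\beta_1:i_2\to k$, $\beta_2:k\to i_1$, $\beta_3:k\to i_3$, $\beta_4:i_4\to k$. Two cell systems $W_1,W_2$ on $\mathcal{G}$ are equivalent if for each pair of adjacent vertices $i,j$ there is a unitary matrix $(u(\sigma,\sigma'))$ indexed by the edges from $i$ to $j$ such that for every triangle $W_1(\triangle_{ijk}^{(\sigma\rho\gamma)})=\sum_{\sigma',\rho',\gamma'}u(\sigma,\sigma')u(\rho,\rho')u(\gamma,\gamma')W_2(\triangle_{ijk}^{(\sigma'\rho'\gamma')})$,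 summing over edges $\sigma':i\to j$, $\rho':j\to k$, $\gamma':k\to i$. *)

theory Defs
  imports "HOL-Analysis.Analysis" "HOL-Library.Numeral_Type" "Graph_Theory.Digraph"
begin

definition q8 :: complex where
  "q8 = exp (\<i> * pi / 8)"

text \<open>The numbers \<open>[m]\<close> are real because \<open>q8\<close> has modulus one, so they are taken in
  \<^typ>\<open>real\<close>; \<open>of_real_qnum\<close> shows that the real part discards nothing.\<close>

definition qnum :: "nat \<Rightarrow> real" where
  "qnum m = Re ((q8 ^ m - inverse q8 ^ m) / (q8 - inverse q8))"

lemma q8_power_diff: "q8 ^ m - inverse q8 ^ m = 2 * \<i> * of_real (sin (real m * pi / 8))"
proof -
  have q: "q8 = cis (pi / 8)"
    by (simp add: q8_def cis_conv_exp)
  have "q8 ^ m = cis (real m * pi / 8)" "inverse q8 ^ m = cis (- (real m * pi / 8))"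
    unfolding q cis_inverse Complex.DeMoivre by simp_all
  then show ?thesis
    by (simp add: complex_eq_iff)
qed

lemma q8_diff: "q8 - inverse q8 = 2 * \<i> * of_real (sin (pi / 8))"
  using q8_power_diff[of 1] by simp

lemma qnum_sin: "qnum m = sin (real m * pi / 8) / sin (pi / 8)"
proof -
  have "(q8 ^ m - inverse q8 ^ m) / (q8 - inverse q8)
      = complex_of_real (sin (real m * pi / 8) / sin (pi / 8))"
    unfolding q8_power_diff q8_diff by simp
  then show ?thesis
    by (simp only: qnum_def Re_complex_of_real)
qed

lemma of_real_qnum:
  "complex_of_real (qnum m) = (q8 ^ m - inverse q8 ^ m) / (q8 - inverse q8)"
  unfolding q8_power_diff q8_diff qnum_sin by simp

definition arcs_from_to :: "('v, 'e) pre_digraph \<Rightarrow> 'v \<Rightarrow> 'v \<Rightarrow> 'e set" where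
  "arcs_from_to G i j = {\<alpha> \<in> arcs G. tail G \<alpha> = i \<and> head G \<alpha> = j}"

definition unitary_on :: "'e set \<Rightarrow> ('e \<Rightarrow> 'e \<Rightarrow> complex) \<Rightarrow> bool" where
  "unitary_on A u \<longleftrightarrow>
    (\<forall>\<sigma>\<in>A. \<forall>\<sigma>'\<in>A. (\<Sum>\<tau>\<in>A. u \<sigma> \<tau> * cnj (u \<sigma>' \<tau>)) = of_bool (\<sigma> = \<sigma>')) \<and>
    (\<forall>\<sigma>\<in>A. \<forall>\<sigma>'\<in>A. (\<Sum>\<tau>\<in>A. cnj (u \<tau> \<sigma>) * u \<tau> \<sigma>') = of_bool (\<sigma> = \<sigma>'))"

text \<open>A positive eigenvector of a nonnegative matrix belongs to its spectral radius, so
  \<open>\<phi>_pos\<close> and \<open>\<phi>_eigen\<close> say that \<open>[3]\<close> is the Perron-Frobenius eigenvalue of the adjacency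
  matrix and \<open>\<phi>\<close> a Perron-Frobenius eigenvector.\<close>

locale cell_graph = fin_digraph G
  for G :: "('v, 'e) pre_digraph" (structure) +
  fixes \<phi> :: "'v \<Rightarrow> real"
  assumes \<phi>_pos: "v \<in> verts G \<Longrightarrow> \<phi> v > 0"
    and \<phi>_eigen: "v \<in> verts G \<Longrightarrow>
          (\<Sum>w\<in>verts G. real (card (arcs_from_to G v w)) * \<phi> w) = qnum 3 * \<phi> v"
begin

definition is_triangle :: "'e \<Rightarrow> 'e \<Rightarrow> 'e \<Rightarrow> bool" where
  "is_triangle \<alpha> \<beta> \<gamma> \<longleftrightarrow> \<alpha> \<in> arcs G \<and> \<beta> \<in> arcs G \<and> \<gamma> \<in> arcs G \<and>
     head G \<alpha> = tail G \<beta> \<and> head G \<beta> = tail G \<gamma> \<and> head G \<gamma> = tail G \<alpha>"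

text \<open>A function on triangles up to rotation is encoded as a function \<open>W \<alpha> \<beta> \<gamma>\<close> of three edges
  that is invariant under rotation of triangles; its values off triangles are irrelevant.\<close>

definition rotation_invariant :: "('e \<Rightarrow> 'e \<Rightarrow> 'e \<Rightarrow> complex) \<Rightarrow> bool" where
  "rotation_invariant W \<longleftrightarrow> (\<forall>\<alpha> \<beta> \<gamma>. is_triangle \<alpha> \<beta> \<gamma> \<longrightarrow> W \<alpha> \<beta> \<gamma> = W \<beta> \<gamma> \<alpha>)"

definition type_I :: "('e \<Rightarrow> 'e \<Rightarrow> 'e \<Rightarrow> complex) \<Rightarrow> bool" where
  "type_I W \<longleftrightarrow>
    (\<forall>i\<in>verts G. \<forall>j\<in>verts G. \<forall>\<alpha>\<in>arcs_from_to G i j. \<forall>\<alpha>'\<in>arcs_from_to G i j.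
      (\<Sum>k\<in>verts G. \<Sum>\<beta>\<in>arcs_from_to G j k. \<Sum>\<gamma>\<in>arcs_from_to G k i.
         W \<alpha> \<beta> \<gamma> * cnj (W \<alpha>' \<beta> \<gamma>))
      = of_bool (\<alpha> = \<alpha>') * of_real (qnum 2 * \<phi> i * \<phi> j))"

definition type_II :: "('e \<Rightarrow> 'e \<Rightarrow> 'e \<Rightarrow> complex) \<Rightarrow> bool" where
  "type_II W \<longleftrightarrow>
    (\<forall>i1\<in>verts G. \<forall>i2\<in>verts G. \<forall>i3\<in>verts G. \<forall>i4\<in>verts G.
     \<forall>\<alpha>1\<in>arcs_from_to G i1 i2. \<forall>\<alpha>2\<in>arcs_from_to G i3 i2.
     \<forall>\<alpha>3\<in>arcs_from_to G i3 i4. \<forall>\<alpha>4\<in>arcs_from_to G i1 i4.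
      (\<Sum>k\<in>verts G.
       \<Sum>\<beta>1\<in>arcs_from_to G i2 k. \<Sum>\<beta>2\<in>arcs_from_to G k i1.
       \<Sum>\<beta>3\<in>arcs_from_to G k i3. \<Sum>\<beta>4\<in>arcs_from_to G i4 k.
         of_real (inverse (\<phi> k)) *
         W \<alpha>1 \<beta>1 \<beta>2 * cnj (W \<alpha>2 \<beta>1 \<beta>3) * W \<alpha>3 \<beta>4 \<beta>3 * cnj (W \<alpha>4 \<beta>4 \<beta>2))
      = of_bool (\<alpha>1 = \<alpha>4) * of_bool (\<alpha>2 = \<alpha>3) * of_real (\<phi> i1 * \<phi> i2 * \<phi> i3)
      + of_bool (\<alpha>1 = \<alpha>2) * of_bool (\<alpha>3 = \<alpha>4) * of_real (\<phi> i1 * \<phi> i2 * \<phi> i4))"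

definition cell_system :: "('e \<Rightarrow> 'e \<Rightarrow> 'e \<Rightarrow> complex) \<Rightarrow> bool" where
  "cell_system W \<longleftrightarrow> rotation_invariant W \<and> type_I W \<and> type_II W"

definition cell_equivalent ::
    "('e \<Rightarrow> 'e \<Rightarrow> 'e \<Rightarrow> complex) \<Rightarrow> ('e \<Rightarrow> 'e \<Rightarrow> 'e \<Rightarrow> complex) \<Rightarrow> bool" where
  "cell_equivalent W1 W2 \<longleftrightarrow>
    (\<exists>u :: 'v \<Rightarrow> 'v \<Rightarrow> 'e \<Rightarrow> 'e \<Rightarrow> complex.
      (\<forall>i j. i \<rightarrow> j \<longrightarrow> unitary_on (arcs_from_to G i j) (u i j)) \<and>
      (\<forall>i\<in>verts G. \<forall>j\<in>verts G. \<forall>k\<in>verts G.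
       \<forall>\<sigma>\<in>arcs_from_to G i j. \<forall>\<rho>\<in>arcs_from_to G j k. \<forall>\<gamma>\<in>arcs_from_to G k i.
         W1 \<sigma> \<rho> \<gamma> =
         (\<Sum>\<sigma>'\<in>arcs_from_to G i j. \<Sum>\<rho>'\<in>arcs_from_to G j k. \<Sum>\<gamma>'\<in>arcs_from_to G k i.
            u i j \<sigma> \<sigma>' * u j k \<rho> \<rho>' * u k i \<gamma> \<gamma>' * W2 \<sigma>' \<rho>' \<gamma>')))"

end

text \<open>The type \<open>6\<close> is the ring of integers modulo 6; in it \<open>6 = 0\<close>.\<close>

datatype e8_vertex = I 6 | J 6

text \<open>The graph has no multiple edges, so its edges are represented by pairs of vertices.\<close>

definition E8 :: "(e8_vertex, e8_vertex \<times> e8_vertex) pre_digraph" where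
  "E8 = \<lparr> verts = UNIV,
     arcs = (\<Union>l. {(I l, J l), (J l, I (l + 1)), (J l, J (l - 1)), (J l, J (l + 2))}),
     tail = fst, head = snd \<rparr>"

fun E8_\<phi> :: "e8_vertex \<Rightarrow> real" where
  "E8_\<phi> (I l) = 1"
| "E8_\<phi> (J l) = qnum 3"

text \<open>\<open>W\<^bsub>a,b,c\<^esub>\<close> in the notation for graphs without multiple edges.\<close>

abbreviation at_vertices ::
    "('v \<times> 'v \<Rightarrow> 'v \<times> 'v \<Rightarrow> 'v \<times> 'v \<Rightarrow> complex) \<Rightarrow> 'v \<Rightarrow> 'v \<Rightarrow> 'v \<Rightarrow> complex" where
  "at_vertices W a b c \<equiv> W (a, b) (b, c) (c, a)"

lemma qnum_3: "qnum 3 = 1 + sqrt 2"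
proof -
  have s: "sin (pi / 8) > 0"
    by (rule sin_gt_zero) (use pi_gt_zero in auto)
  have "sin (3 * (pi / 8)) = sin (2 * (pi / 8) + pi / 8)"
    by (simp add: algebra_simps)
  also have "\<dots> = sin (2 * (pi / 8)) * cos (pi / 8) + cos (2 * (pi / 8)) * sin (pi / 8)"
    by (rule sin_add)
  also have "\<dots> = (2 * (cos (pi / 8))\<^sup>2 + cos (2 * (pi / 8))) * sin (pi / 8)"
    unfolding sin_double by (simp add: algebra_simps power2_eq_square)
  also have "2 * (cos (pi / 8))\<^sup>2 = 1 + cos (2 * (pi / 8))"
    unfolding cos_double_cos by simp
  also have "2 * (pi / 8) = pi / 4"
    by simp
  finally show ?thesis
    using s by (simp add: qnum_sin cos_45 field_simps)
qed

lemma UNIV_e8_vertex: "(UNIV :: e8_vertex set) = range I \<union> range J"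
  using e8_vertex.exhaust by blast

interpretation E8: cell_graph E8 E8_\<phi>
proof
  have fin: "finite (UNIV :: e8_vertex set)"
    by (simp add: UNIV_e8_vertex)
  then have fin2: "finite (UNIV :: (e8_vertex \<times> e8_vertex) set)"
    by (simp add: finite_prod)
  show "finite (verts E8)"
    using fin by (simp add: E8_def)
  show "finite (arcs E8)"
    using fin2 by (rule finite_subset[rotated]) simp
  fix v
  show "E8_\<phi> v > 0"
    by (cases v) (simp_all add: qnum_3 add_pos_pos)
  define S where "S = {w. (v, w) \<in> arcs E8}"
  have "arcs_from_to E8 v w = (if w \<in> S then {(v, w)} else {})" for w
    by (auto simp: arcs_from_to_def S_def E8_def)
  then have "(\<Sum>w\<in>verts E8. real (card (arcs_from_to E8 v w)) * E8_\<phi> w)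
      = (\<Sum>w\<in>UNIV. if w \<in> S then E8_\<phi> w else 0)"
    by (intro sum.cong) (auto simp: E8_def)
  also have "\<dots> = sum E8_\<phi> S"
    using fin by (simp add: sum.If_cases)
  also have "\<dots> = qnum 3 * E8_\<phi> v"
  proof (cases v)
    case (I l)
    then have "S = {J l}"
      by (auto simp: S_def E8_def)
    with I show ?thesis
      by simp
  next
    case (J l)
    have "l - 1 \<noteq> l + 2"
    proof
      assume "l - 1 = l + 2"
      then have "(3 :: 6) = 0"
        by (simp add: algebra_simps)
      then show False
        by simp
    qed
    moreover from J have "S = {I (l + 1), J (l - 1), J (l + 2)}"
      by (auto simp: S_def E8_def)
    ultimately show ?thesis
      using J by (simp add: qnum_3 algebra_simps)
  qed
  finally show "(\<Sum>w\<in>verts E8. real (card (arcs_from_to E8 v w)) * E8_\<phi> w) = qnum 3 * E8_\<phi> v" .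
qed (auto simp: E8_def)

end

theory Submission
  imports Defs
begin

text \<open>
  Up to rotation the graph has three families of triangles, with values
  \<open>A l\<close> on \<open>I l \<rightarrow> J l \<rightarrow> J (l - 1)\<close>, \<open>B l\<close> on \<open>J l \<rightarrow> J (l - 1) \<rightarrow> J (l - 2)\<close> and
  \<open>C l\<close> on \<open>J l \<rightarrow> J (l + 2) \<rightarrow> J (l + 4)\<close>; the last depends only on the parity of \<open>l\<close>.

  The moduli are forced. Condition (I) at the edges \<open>I l \<rightarrow> J l\<close> gives \<open>\<bar>A l\<bar>\<close>, at
  \<open>J l \<rightarrow> J (l - 1)\<close> it gives the sum of the squares of two consecutive \<open>\<bar>B l\<bar>\<close>, and at
  \<open>J l \<rightarrow> J (l + 2)\<close> it expresses \<open>\<bar>C l\<bar>\<close> by \<open>\<bar>B (l + 2)\<bar>\<close>. Condition (II) with all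
  four edges equal to \<open>J l \<rightarrow> J (l + 2)\<close> then makes every \<open>\<bar>B l\<bar>\<^sup>2\<close> a root of one and the
  same quadratic. Two consecutive ones cannot be the two different roots, because their sum is
  \<open>\<surd>2 [2] [3]\<close> while the sum of the roots is \<open>[2] [3]\<^sup>2\<close>; so all of them agree
  (\<open>cell_norms\<close>).

  The phases of the edges can be chosen freely and absorb the phases of all \<open>A l\<close> and \<open>B l\<close>.
  The relative phase of \<open>B l B (l + 2) B (l + 4)\<close> and \<open>C l\<close> changes only by the product of the
  phases of the six edges \<open>J m \<rightarrow> J (m - 1)\<close>, which is the same for even and odd \<open>l\<close>. Hence the
  only invariant is the ratio of these relative phases for the two parities.
  Condition (II) for the quadrilateral on \<open>J l\<close>, \<open>J (l + 2)\<close>, \<open>J (l + 3)\<close>, \<open>J (l - 1)\<close>, whose right-hand side vanishes, says that this ratio is \<open>-1\<close>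
  (\<open>relative_phase_step\<close>). This is also why the two values \<open>C l\<close> have opposite signs. Giving each
  edge \<open>J m \<rightarrow> J (m - 1)\<close> the same phase, a sixth root of the quotient of the relative phases of
  the two systems, produces an equivalence (\<open>cell_equivalent_cell_E8\<close>).
  Conversely the displayed values satisfy (I) and (II) by a check of all quadrilaterals up to the shift of \<open>l\<close> (\<open>cell_system_cell_E8\<close>).
\<close>

section \<open>Edges, sums and the conditions at the level of vertices\<close>

fun adj :: "e8_vertex \<Rightarrow> e8_vertex \<Rightarrow> bool" where
  "adj (I l) (I m) = False"
| "adj (I l) (J m) = (m = l)"
| "adj (J l) (I m) = (m = l + 1)"
| "adj (J l) (J m) = (m = l - 1 \<or> m = l + 2)"

lemma arcs_E8: "(x, y) \<in> arcs E8 \<longleftrightarrow> adj x y"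
  by (cases x; cases y) (auto simp: E8_def)

lemma verts_E8: "verts E8 = UNIV"
  by (simp add: E8_def)

lemma arcs_from_to_E8: "arcs_from_to E8 x y = (if adj x y then {(x, y)} else {})"
  by (auto simp flip: arcs_E8) (auto simp: arcs_from_to_def E8_def)

lemma ball_arcs_from_to_E8: "(\<forall>\<alpha>\<in>arcs_from_to E8 x y. P \<alpha>) \<longleftrightarrow> (adj x y \<longrightarrow> P (x, y))"
  by (simp add: arcs_from_to_E8)

lemma down_neq_up: "l - 1 \<noteq> l + (2 :: 6)" "2 + l \<noteq> l - (1 :: 6)"
  by (simp_all add: algebra_simps)

text \<open>Simplification of indices leaves sums with the constant in front; these rules bring them
  back to one normal form modulo 6.\<close>

lemma index_normal_form:
  fixes l :: 6
  shows "1 + l = l + 1" "numeral n + l = l + numeral n" "l + 6 = l"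
  by simp_all

lemma all_mod_6: "(\<forall>x :: 6. P x) \<longleftrightarrow> P 0 \<and> P 1 \<and> P 2 \<and> P 3 \<and> P 4 \<and> P 5"
proof -
  have "{0, 1, 2, 3, 4, 5} = (UNIV :: 6 set)"
    by (rule card_subset_eq) simp_all
  then have "(\<forall>x :: 6. P x) \<longleftrightarrow> (\<forall>x\<in>{0, 1, 2, 3, 4, 5}. P x)"
    by simp
  then show ?thesis
    by simp
qed

lemma adj_cases [consumes 1, case_names IJ JI down up]:
  assumes "adj x y"
    and "\<And>l. x = I l \<Longrightarrow> y = J l \<Longrightarrow> Q"
    and "\<And>l. x = J (l - 1) \<Longrightarrow> y = I l \<Longrightarrow> Q"
    and "\<And>l. x = J l \<Longrightarrow> y = J (l - 1) \<Longrightarrow> Q"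
    and "\<And>l. x = J l \<Longrightarrow> y = J (l + 2) \<Longrightarrow> Q"
  shows Q
  using assms by (cases x; cases y) (fastforce simp: algebra_simps)+

lemma finite_e8_vertex: "finite (A :: e8_vertex set)"
  by (rule finite_subset[OF subset_UNIV]) (simp add: UNIV_e8_vertex)

lemma sum_Collect_if: "(\<Sum>k | P k. f k) = (\<Sum>k\<in>UNIV. if P k then f k else 0)"
  for P :: "e8_vertex \<Rightarrow> bool"
  by (simp add: sum.If_cases finite_e8_vertex)

text \<open>Every sum in (I) and (II) runs over successors of a fixed vertex subject to further adjacency
  conditions, so these two equations evaluate all of them.\<close>

lemma sum_successors:
  fixes f :: "e8_vertex \<Rightarrow> 'a :: comm_monoid_add"
  shows "(\<Sum>k | adj (I l) k \<and> P k. f k) = (if P (J l) then f (J l) else 0)"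
    and "(\<Sum>k | adj (J l) k \<and> P k. f k) =
      (if P (I (l + 1)) then f (I (l + 1)) else 0) +
      ((if P (J (l - 1)) then f (J (l - 1)) else 0) +
       (if P (J (l + 2)) then f (J (l + 2)) else 0))"
proof -
  have out: "{k. adj (I l) k} = {J l}" "{k. adj (J l) k} = {I (l + 1), J (l - 1), J (l + 2)}"
    by (auto elim: adj.elims)
  have restrict: "(\<Sum>k | adj x k \<and> P k. f k) = (\<Sum>k\<in>{k. adj x k}. if P k then f k else 0)" for x
    by (simp add: sum.inter_filter[symmetric] finite_e8_vertex)
  show "(\<Sum>k | adj (I l) k \<and> P k. f k) = (if P (J l) then f (J l) else 0)"
    and "(\<Sum>k | adj (J l) k \<and> P k. f k) =
      (if P (I (l + 1)) then f (I (l + 1)) else 0) +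
      ((if P (J (l - 1)) then f (J (l - 1)) else 0) +
       (if P (J (l + 2)) then f (J (l + 2)) else 0))"
    unfolding restrict out using down_neq_up(1)[of l] by simp_all
qed

lemma is_triangle_E8: "E8.is_triangle \<alpha> \<beta> \<gamma> \<longleftrightarrow>
  (\<exists>x y z. adj x y \<and> adj y z \<and> adj z x \<and> \<alpha> = (x, y) \<and> \<beta> = (y, z) \<and> \<gamma> = (z, x))"
proof -
  have "tail E8 = fst" "head E8 = snd"
    by (simp_all add: E8_def)
  then show ?thesis
    by (cases \<alpha>; cases \<beta>; cases \<gamma>) (auto simp: E8.is_triangle_def arcs_E8)
qed

lemma rotation_invariant_E8:
  "E8.rotation_invariant W \<longleftrightarrow> (\<forall>x y z. adj x y \<longrightarrow> adj y z \<longrightarrow> adj z x \<longrightarrow>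
     at_vertices W x y z = at_vertices W y z x)"
  unfolding E8.rotation_invariant_def is_triangle_E8 by blast

lemma type_I_E8:
  "E8.type_I W \<longleftrightarrow> (\<forall>x y. adj x y \<longrightarrow>
     (\<Sum>k | adj y k \<and> adj k x. at_vertices W x y k * cnj (at_vertices W x y k))
       = of_real (qnum 2 * E8_\<phi> x * E8_\<phi> y))"
proof -
  have sums: "(\<Sum>k\<in>UNIV. \<Sum>\<beta>\<in>arcs_from_to E8 y k. \<Sum>\<gamma>\<in>arcs_from_to E8 k x. f k \<beta> \<gamma>)
      = (\<Sum>k | adj y k \<and> adj k x. f k (y, k) (k, x))"
    for x y and f :: "_ \<Rightarrow> _ \<Rightarrow> _ \<Rightarrow> complex"
    unfolding sum_Collect_if by (intro sum.cong) (auto simp: arcs_from_to_E8)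
  show ?thesis
    by (simp add: E8.type_I_def verts_E8 ball_arcs_from_to_E8 sums)
qed

lemma type_II_E8:
  "E8.type_II W \<longleftrightarrow> (\<forall>x y z v. adj x y \<longrightarrow> adj z y \<longrightarrow> adj z v \<longrightarrow> adj x v \<longrightarrow>
     (\<Sum>k | adj y k \<and> adj k x \<and> adj k z \<and> adj v k. of_real (inverse (E8_\<phi> k)) *
         at_vertices W x y k * cnj (at_vertices W z y k) *
         at_vertices W z v k * cnj (at_vertices W x v k))
       = of_real (of_bool (y = v) * (E8_\<phi> x * E8_\<phi> y * E8_\<phi> z)
       + of_bool (x = z) * (E8_\<phi> x * E8_\<phi> y * E8_\<phi> v)))"
proof -
  have sums: "(\<Sum>k\<in>UNIV. \<Sum>\<beta>1\<in>arcs_from_to E8 y k. \<Sum>\<beta>2\<in>arcs_from_to E8 k x.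
         \<Sum>\<beta>3\<in>arcs_from_to E8 k z. \<Sum>\<beta>4\<in>arcs_from_to E8 v k. f k \<beta>1 \<beta>2 \<beta>3 \<beta>4)
      = (\<Sum>k | adj y k \<and> adj k x \<and> adj k z \<and> adj v k. f k (y, k) (k, x) (k, z) (v, k))"
    for x y z v and f :: "_ \<Rightarrow> _ \<Rightarrow> _ \<Rightarrow> _ \<Rightarrow> _ \<Rightarrow> complex"
    unfolding sum_Collect_if by (intro sum.cong) (auto simp: arcs_from_to_E8)
  have rhs: "of_bool ((x, y) = (x, v)) * of_bool ((z, y) = (z, v)) * of_real a
      + of_bool ((x, y) = (z, y)) * of_bool ((z, v) = (x, v)) * of_real b
      = complex_of_real (of_bool (y = v) * a + of_bool (x = z) * b)"
    for x y z v :: e8_vertex and a b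
    by auto
  show ?thesis
    unfolding E8.type_II_def verts_E8 ball_arcs_from_to_E8 sums rhs by blast
qed

text \<open>The edges of a triangle between \<open>J\<close>-vertices shift the index by \<open>-1\<close> or \<open>2\<close> with sum 0
  modulo 6, which leaves only the cyclic patterns \<open>-1, -1, 2\<close> and \<open>2, 2, 2\<close>; and an \<open>I\<close>-vertex has
  one predecessor and one successor.\<close>

lemma triangle_induct [consumes 3, case_names rotate A B C]:
  assumes "adj x y" "adj y z" "adj z x"
    and rot: "\<And>x y z. adj x y \<Longrightarrow> adj y z \<Longrightarrow> adj z x \<Longrightarrow> P x y z \<Longrightarrow> P y z x"
    and A: "\<And>l. P (I l) (J l) (J (l - 1))"
    and B: "\<And>l. P (J l) (J (l - 1)) (J (l - 2))"
    and C: "\<And>l. P (J l) (J (l + 2)) (J (l + 4))"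
  shows "P x y z"
proof -
  have A': "P (J l) (J (l - 1)) (I l)" "P (J (l - 1)) (I l) (J l)" for l
    using rot[OF _ _ _ A[of l]] rot[OF _ _ _ rot[OF _ _ _ A[of l]]] by auto
  have B': "P (J (l - 1)) (J (l - 2)) (J l)" "P (J (l - 2)) (J l) (J (l - 1))" for l
    using rot[OF _ _ _ B[of l]] rot[OF _ _ _ rot[OF _ _ _ B[of l]]] by auto
  from assms(1) show ?thesis
  proof (cases rule: adj_cases)
    case (IJ l)
    then have "z = J (l - 1)"
      using assms(2,3) by (cases z) auto
    then show ?thesis
      using IJ A by simp
  next
    case (JI l)
    then have "z = J l"
      using assms(2,3) by (cases z) auto
    then show ?thesis
      using JI A' by simp
  next
    case (down l)
    then have "z = I l \<or> z = J (l - 2) \<or> z = J (l + 1)"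
      using assms(2,3) by (cases z) auto
    then show ?thesis
      using down A'(1)[of l] B[of l] B'(1)[of "l + 1"] by auto
  next
    case (up l)
    then have "z = J (l + 1) \<or> z = J (l + 4)"
      using assms(2,3) by (cases z) (auto simp: algebra_simps)
    then show ?thesis
      using up B'(2)[of "l + 2"] C[of l] by (auto simp: algebra_simps)
  qed
qed

section \<open>The numbers [2], [3], [4] and the moduli of the cells\<close>

lemma qnum_2_pos: "qnum 2 > 0"
  unfolding qnum_sin by (intro divide_pos_pos sin_gt_zero) (use pi_gt_zero in auto)

lemma qnum_3_pos: "qnum 3 > 0"
  by (simp add: qnum_3 add_pos_pos)

lemma qnum_2_sq: "qnum 2 * qnum 2 = 2 + sqrt 2"
proof -
  have "sin (pi / 8) > 0"
    by (rule sin_gt_zero) (use pi_gt_zero in auto)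
  then have "qnum 2 = 2 * cos (pi / 8)"
    using sin_double[of "pi / 8"] by (simp add: qnum_sin)
  then have "qnum 2 * qnum 2 = 2 * (1 + cos (2 * (pi / 8)))"
    unfolding cos_double_cos by (simp add: power2_eq_square)
  then show ?thesis
    by (simp add: cos_45)
qed

lemma qnum_4: "qnum 4 = sqrt 2 * qnum 2"
proof -
  have "sin (4 * (pi / 8)) = 2 * sin (2 * (pi / 8)) * cos (2 * (pi / 8))"
    using sin_double[of "2 * (pi / 8)"] by simp
  then show ?thesis
    by (simp add: qnum_sin cos_45 mult.commute)
qed

lemma inverse_one_plus_sqrt_2: "inverse (1 + sqrt 2) = sqrt 2 - 1"
  by (rule inverse_unique) (simp add: algebra_simps)

definition cA :: real where "cA = sqrt (qnum 2 * qnum 3)"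
definition cB :: real where "cB = qnum 2 * sqrt (qnum 3) / sqrt (qnum 4)"
definition cC :: real where "cC = qnum 2 * qnum 3 / sqrt (qnum 4)"

text \<open>The squares lie in the span of \<open>[2]\<close> and \<open>[2] \<surd>2\<close>; together with \<open>qnum_2_sq\<close> these forms
  turn every instance of (I) and (II) into a polynomial identity that is decided by
  normalization.\<close>

lemma cA_sq: "cA * cA = qnum 2 * (1 + sqrt 2)"
  and cB_sq: "cB * cB = qnum 2 * (2 + sqrt 2) / 2"
  and cC_sq: "cC * cC = qnum 2 * (4 + 3 * sqrt 2) / 2"
  and c_pos: "cA > 0" "cB > 0" "cC > 0"
proof -
  have q4: "qnum 4 > 0"
    using qnum_2_pos by (simp add: qnum_4)
  show "cA * cA = qnum 2 * (1 + sqrt 2)"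
    using qnum_2_pos qnum_3_pos by (simp add: cA_def qnum_3)
  have "cB * cB = qnum 2 * qnum 2 * qnum 3 / qnum 4"
    using q4 qnum_3_pos by (simp add: cB_def)
  also have "\<dots> = qnum 2 * (2 + sqrt 2) / 2"
    using qnum_2_pos by (simp add: qnum_4 qnum_3 field_simps)
  finally show "cB * cB = qnum 2 * (2 + sqrt 2) / 2" .
  have "cC * cC = qnum 2 * qnum 2 * (qnum 3 * qnum 3) / qnum 4"
    using q4 by (simp add: cC_def)
  also have "\<dots> = qnum 2 * (4 + 3 * sqrt 2) / 2"
    using qnum_2_pos by (simp add: qnum_4 qnum_3 field_simps)
  finally show "cC * cC = qnum 2 * (4 + 3 * sqrt 2) / 2" .
  show "cA > 0" "cB > 0" "cC > 0"
    using qnum_2_pos qnum_3_pos q4 by (auto simp: cA_def cB_def cC_def)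
qed

section \<open>Existence\<close>

definition parity_sign :: "6 \<Rightarrow> real" where
  "parity_sign l = (if l \<in> {1, 3, 5} then 1 else - 1)"

lemma parity_sign_plus_1: "parity_sign (l + 1) = - parity_sign l"
proof -
  have "\<forall>l. parity_sign (l + 1) = - parity_sign l"
    unfolding all_mod_6 by (simp add: parity_sign_def)
  then show ?thesis
    by blast
qed

lemma parity_sign_shift:
  "parity_sign (l - 1) = - parity_sign l"
  "parity_sign (l + 2) = parity_sign l" "parity_sign (l + 3) = - parity_sign l"
  "parity_sign (l + 4) = parity_sign l" "parity_sign (l + 5) = - parity_sign l"
  using parity_sign_plus_1[of "l - 1"] parity_sign_plus_1[of l] parity_sign_plus_1[of "l + 1"]
    parity_sign_plus_1[of "l + 2"] parity_sign_plus_1[of "l + 3"] parity_sign_plus_1[of "l + 4"]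
  by (simp_all add: algebra_simps)

lemma parity_sign_sq: "parity_sign l * parity_sign l = 1"
    "parity_sign l * (parity_sign l * x) = x"
  by (simp_all add: parity_sign_def)

text \<open>On triangles the condition \<open>m = l + 2 \<and> n = m + 2\<close> singles out the pattern \<open>2, 2, 2\<close> in every
  rotation, since \<open>-1, -1, 2\<close> has no two consecutive steps by 2.\<close>

fun cell_value :: "e8_vertex \<Rightarrow> e8_vertex \<Rightarrow> e8_vertex \<Rightarrow> real" where
  "cell_value (J l) (J m) (J n) = (if m = l + 2 \<and> n = m + 2 then parity_sign l * cC else cB)"
| "cell_value _ _ _ = cA"

definition cell_E8 ::
    "e8_vertex \<times> e8_vertex \<Rightarrow> e8_vertex \<times> e8_vertex \<Rightarrow> e8_vertex \<times> e8_vertex \<Rightarrow> complex" where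
  "cell_E8 e f g = complex_of_real (cell_value (fst e) (fst f) (fst g))"

lemma cell_E8_values:
  "at_vertices cell_E8 (I l) (J l) (J (l - 1)) = of_real cA"
  "at_vertices cell_E8 (J l) (J (l - 1)) (J (l - 2)) = of_real cB"
  "at_vertices cell_E8 (J l) (J (l + 2)) (J (l + 4)) = of_real (parity_sign l * cC)"
  using down_neq_up(1)[of l] by (simp_all add: cell_E8_def)

lemma rotation_invariant_cell_E8: "E8.rotation_invariant cell_E8"
  unfolding rotation_invariant_E8
proof (intro allI impI)
  fix x y z
  assume "adj x y" "adj y z" "adj z x"
  \<comment> \<open>Invariance under both rotations is itself a rotation-invariant property, so that the
    induction applies.\<close>
  then have "cell_value x y z = cell_value y z x \<and> cell_value x y z = cell_value z x y"
    by (induction rule: triangle_induct) (auto simp: down_neq_up algebra_simps parity_sign_shift)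
  then show "at_vertices cell_E8 x y z = at_vertices cell_E8 y z x"
    by (simp add: cell_E8_def)
qed

lemma type_I_cell_E8: "E8.type_I cell_E8"
proof -
  have "(\<Sum>k | adj y k \<and> adj k x. cell_value x y k * cell_value x y k)
      = qnum 2 * E8_\<phi> x * E8_\<phi> y" if "adj x y" for x y
    using that
    by (cases rule: adj_cases)
      (simp_all add: sum_successors cA_sq cB_sq cC_sq qnum_3 down_neq_up algebra_simps
        add_divide_distrib diff_divide_distrib parity_sign_sq parity_sign_shift del: sum_constant)
  then show ?thesis
    unfolding type_I_E8 by (simp add: cell_E8_def flip: of_real_mult of_real_sum)
qed

lemma mult_left_eq:
  fixes a b c x :: "'a :: semigroup_mult"
  shows "a * b = c \<Longrightarrow> a * (b * x) = c * x"
  by (simp flip: mult.assoc)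

text \<open>The case analysis fixes the first edge \<open>x \<rightarrow> y\<close> and lists the pairs \<open>z\<close>, \<open>v\<close> that close up a
  quadrilateral. The right-hand side vanishes only if \<open>x \<noteq> z\<close> and \<open>y \<noteq> v\<close>, which leaves
  \<open>z = J (l + 3)\<close> with \<open>y\<close> and \<open>v\<close> the two common successors of \<open>J l\<close> and \<open>J (l + 3)\<close>: there the two
  terms of the sum cancel because of the opposite signs of the values \<open>\<plusminus>cC\<close>.\<close>

lemma type_II_cell_E8: "E8.type_II cell_E8"
proof -
  have "sqrt 2 * sqrt 2 = 2"
    by simp
  note squares = cA_sq cB_sq cC_sq qnum_2_sq this
  note evaluate = sum_successors squares squares[THEN mult_left_eq] qnum_3
    inverse_one_plus_sqrt_2 down_neq_up algebra_simps add_divide_distrib diff_divide_distrib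
    parity_sign_sq parity_sign_shift
  have real: "(\<Sum>k | adj y k \<and> adj k x \<and> adj k z \<and> adj v k. inverse (E8_\<phi> k) *
         cell_value x y k * cell_value z y k * cell_value z v k * cell_value x v k)
       = of_bool (y = v) * (E8_\<phi> x * E8_\<phi> y * E8_\<phi> z)
       + of_bool (x = z) * (E8_\<phi> x * E8_\<phi> y * E8_\<phi> v)"
    if a: "adj x y" "adj z y" "adj z v" "adj x v" for x y z v
    using a(1)
  proof (cases rule: adj_cases)
    case (IJ l)
    with a have [simp]: "v = J l"
      by (cases v) auto
    from a(2) show ?thesis
      unfolding IJ by (cases rule: adj_cases) (simp_all add: IJ evaluate del: sum_constant)
  next
    case (JI l)
    with a have [simp]: "z = J (l - 1)"
      by (cases z) auto
    from a(4) show ?thesis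
      unfolding JI by (cases rule: adj_cases) (simp_all add: JI evaluate del: sum_constant)
  next
    case (down l)
    have "z = I (l - 1) \<and> v = J (l - 1) \<or>
        z = J l \<and> (v = I (l + 1) \<or> v = J (l - 1) \<or> v = J (l + 2)) \<or>
        z = J (l + 3) \<and> (v = J (l - 1) \<or> v = J (l + 2))"
      using a(2-4) unfolding down by (cases z; cases v) (auto simp: algebra_simps)
    then show ?thesis
      unfolding down by (elim disjE conjE) (simp_all add: evaluate del: sum_constant)
  next
    case (up l)
    have "z = I (l + 2) \<and> v = J (l + 2) \<or>
        z = J l \<and> (v = I (l + 1) \<or> v = J (l - 1) \<or> v = J (l + 2)) \<or>
        z = J (l + 3) \<and> (v = J (l - 1) \<or> v = J (l + 2))"
      using a(2-4) unfolding up by (cases z; cases v) (auto simp: algebra_simps)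
    then show ?thesis
      unfolding up by (elim disjE conjE) (simp_all add: evaluate del: sum_constant)
  qed
  show ?thesis
    unfolding type_II_E8
  proof (intro allI impI)
    fix x y z v
    assume "adj x y" "adj z y" "adj z v" "adj x v"
    from real[OF this, THEN arg_cong[of _ _ complex_of_real]]
    show "(\<Sum>k | adj y k \<and> adj k x \<and> adj k z \<and> adj v k. of_real (inverse (E8_\<phi> k)) *
         at_vertices cell_E8 x y k * cnj (at_vertices cell_E8 z y k) *
         at_vertices cell_E8 z v k * cnj (at_vertices cell_E8 x v k))
       = of_real (of_bool (y = v) * (E8_\<phi> x * E8_\<phi> y * E8_\<phi> z)
       + of_bool (x = z) * (E8_\<phi> x * E8_\<phi> y * E8_\<phi> v))"
      by (simp add: cell_E8_def)
  qed
qed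

lemma cell_system_cell_E8: "E8.cell_system cell_E8"
  by (simp add: E8.cell_system_def rotation_invariant_cell_E8 type_I_cell_E8 type_II_cell_E8)

section \<open>The moduli of an arbitrary cell system\<close>

definition valA where "valA W l = at_vertices W (I l) (J l) (J (l - 1))"
definition valB where "valB W l = at_vertices W (J l) (J (l - 1)) (J (l - 2))"
definition valC where "valC W l = at_vertices W (J l) (J (l + 2)) (J (l + 4))"

lemma rotated_values:
  assumes "E8.rotation_invariant W"
  shows "at_vertices W (I l) (J l) (J (l - 1)) = valA W l"
    "at_vertices W (J l) (J (l - 1)) (I l) = valA W l"
    "at_vertices W (J l) (J (l - 1)) (J (l - 2)) = valB W l"
    "at_vertices W (J l) (J (l - 1)) (J (l + 1)) = valB W (l + 1)"
    "at_vertices W (J l) (J (l + 2)) (J (l + 1)) = valB W (l + 2)"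
    "at_vertices W (J l) (J (l + 2)) (J (l + 4)) = valC W l"
    "at_vertices W (J (l + 2)) (J (l + 4)) (J l) = valC W l"
proof -
  note r = assms[unfolded rotation_invariant_E8, rule_format]
  show "at_vertices W (J l) (J (l - 1)) (I l) = valA W l"
    using r[of "I l" "J l" "J (l - 1)"] by (simp add: valA_def)
  show "at_vertices W (J l) (J (l - 1)) (J (l + 1)) = valB W (l + 1)"
    using r[of "J (l + 1)" "J l" "J (l - 1)"] by (simp add: valB_def)
  show "at_vertices W (J l) (J (l + 2)) (J (l + 1)) = valB W (l + 2)"
    using r[of "J l" "J (l + 2)" "J (l + 1)"] r[of "J (l + 2)" "J (l + 1)" "J l"]
    by (simp add: valB_def index_normal_form)
  show "at_vertices W (J (l + 2)) (J (l + 4)) (J l) = valC W l"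
    using r[of "J l" "J (l + 2)" "J (l + 4)"] by (simp add: valC_def algebra_simps)
qed (simp_all add: valA_def valB_def valC_def)

lemma type_I_values:
  assumes "E8.rotation_invariant W" and "E8.type_I W"
  shows "(cmod (valA W l))\<^sup>2 = qnum 2 * qnum 3"
    and "(cmod (valA W l))\<^sup>2 + (cmod (valB W l))\<^sup>2 + (cmod (valB W (l + 1)))\<^sup>2
      = qnum 2 * (qnum 3)\<^sup>2"
    and "(cmod (valB W (l + 2)))\<^sup>2 + (cmod (valC W l))\<^sup>2 = qnum 2 * (qnum 3)\<^sup>2"
proof -
  note rots = rotated_values[OF assms(1)]
  have type_I: "(\<Sum>k | adj y k \<and> adj k x. (cmod (at_vertices W x y k))\<^sup>2)
      = qnum 2 * E8_\<phi> x * E8_\<phi> y" if "adj x y" for x y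
  proof -
    have "complex_of_real (\<Sum>k | adj y k \<and> adj k x. (cmod (at_vertices W x y k))\<^sup>2)
       = complex_of_real (qnum 2 * E8_\<phi> x * E8_\<phi> y)"
      unfolding of_real_sum complex_norm_square
      using assms(2) that unfolding type_I_E8 by simp
    then show ?thesis
      by (simp only: of_real_eq_iff)
  qed
  show "(cmod (valA W l))\<^sup>2 = qnum 2 * qnum 3"
    using type_I[of "I l" "J l"] by (simp add: sum_successors rots)
  show "(cmod (valA W l))\<^sup>2 + (cmod (valB W l))\<^sup>2 + (cmod (valB W (l + 1)))\<^sup>2
      = qnum 2 * (qnum 3)\<^sup>2"
    using type_I[of "J l" "J (l - 1)"]
    by (simp add: sum_successors rots power2_eq_square index_normal_form)
  show "(cmod (valB W (l + 2)))\<^sup>2 + (cmod (valC W l))\<^sup>2 = qnum 2 * (qnum 3)\<^sup>2"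
    using type_I[of "J l" "J (l + 2)"]
    by (simp add: sum_successors rots power2_eq_square index_normal_form)
qed

text \<open>The first equation is (II) with all four edges equal to \<open>J l \<rightarrow> J (l + 2)\<close>. The second one is
  the quadrilateral \<open>J l \<rightarrow> J (l + 2) \<leftarrow> J (l + 3) \<rightarrow> J (l - 1) \<leftarrow> J l\<close>, which exists because
  \<open>-1\<close> and \<open>2\<close> differ by 3 modulo 6; its two middle vertices are \<open>J (l + 1)\<close> and
  \<open>J (l + 4)\<close>.\<close>

lemma type_II_values:
  assumes "E8.rotation_invariant W" and "E8.type_II W"
  shows "(cmod (valB W (l + 2))) ^ 4 + (cmod (valC W l)) ^ 4 = 2 * (qnum 3) ^ 4"
    and "valB W (l + 2) * cnj (valB W (l + 3)) * valC W (l + 1) * cnj (valB W (l + 1)) +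
      valC W l * cnj (valB W (l + 4)) * valB W (l + 5) * cnj (valB W l) = 0"
proof -
  note rots = rotated_values[OF assms(1)]
  note type_II = assms(2)[unfolded type_II_E8, rule_format]
  have q3: "qnum 3 \<noteq> 0"
    using qnum_3_pos by simp
  have cmod4: "complex_of_real (cmod z ^ 4) = z * cnj z * z * cnj z" for z
  proof -
    have "cmod z ^ 4 = (cmod z)\<^sup>2 * (cmod z)\<^sup>2"
      by (simp add: power_add[symmetric])
    then show ?thesis
      by (simp only: of_real_mult complex_norm_square mult.assoc)
  qed
  have "complex_of_real (inverse (qnum 3) * ((cmod (valB W (l + 2))) ^ 4 + (cmod (valC W l)) ^ 4))
      = complex_of_real (2 * (qnum 3) ^ 3)"
    unfolding of_real_mult of_real_add cmod4
    using type_II[of "J l" "J (l + 2)" "J l" "J (l + 2)"]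
    by (simp add: sum_successors rots index_normal_form distrib_left mult_ac power3_eq_cube)
  then have "qnum 3 * (inverse (qnum 3) * ((cmod (valB W (l + 2))) ^ 4 + (cmod (valC W l)) ^ 4))
      = qnum 3 * (2 * (qnum 3) ^ 3)"
    by (simp only: of_real_eq_iff)
  with q3 have "(cmod (valB W (l + 2))) ^ 4 + (cmod (valC W l)) ^ 4 = qnum 3 * (2 * (qnum 3) ^ 3)"
    by (simp only: mult.assoc[symmetric] right_inverse) simp
  then show "(cmod (valB W (l + 2))) ^ 4 + (cmod (valC W l)) ^ 4 = 2 * (qnum 3) ^ 4"
    by (simp add: eval_nat_numeral)
  have minus: "l - 1 = l + 5" "l - 2 = l + 4"
    by simp_all
  have quadrilateral:
    "at_vertices W (J (l + 3)) (J (l + 2)) (J (l + 1)) = valB W (l + 3)"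
    "at_vertices W (J (l + 3)) (J (l - 1)) (J (l + 1)) = valC W (l + 1)"
    "at_vertices W (J (l + 3)) (J (l + 2)) (J (l + 4)) = valB W (l + 4)"
    "at_vertices W (J (l + 3)) (J (l - 1)) (J (l + 4)) = valB W (l + 5)"
    "at_vertices W (J l) (J (l - 1)) (J (l + 4)) = valB W l"
    using rots(3)[of "l + 3"] rots(7)[of "l + 1"] rots(4)[of "l + 3"] rots(5)[of "l + 3"] rots(3)[of l]
    by (simp_all add: minus index_normal_form)
  show "valB W (l + 2) * cnj (valB W (l + 3)) * valC W (l + 1) * cnj (valB W (l + 1)) +
      valC W l * cnj (valB W (l + 4)) * valB W (l + 5) * cnj (valB W l) = 0"
  proof -
    have "inverse (complex_of_real (qnum 3)) *
      (valB W (l + 2) * cnj (valB W (l + 3)) * valC W (l + 1) * cnj (valB W (l + 1)) +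
      valC W l * cnj (valB W (l + 4)) * valB W (l + 5) * cnj (valB W l)) = 0"
      using type_II[of "J l" "J (l + 2)" "J (l + 3)" "J (l - 1)"]
      by (simp add: sum_successors rots index_normal_form quadrilateral distrib_left mult.assoc del: mult_eq_0_iff)
    then show ?thesis
      using q3 by simp
  qed
qed

text \<open>Here \<open>p\<close> and \<open>p'\<close> are roots of the same quadratic with root sum \<open>q t\<^sup>2\<close>; since their sum is a
  different number, they are the same root.\<close>

lemma equal_roots:
  fixes p p' q s t :: real
  assumes "p + p' = s * q * t" "p\<^sup>2 + (q * t\<^sup>2 - p)\<^sup>2 = r" "p'\<^sup>2 + (q * t\<^sup>2 - p')\<^sup>2 = r"
    and "q > 0" "t > 0" "s \<noteq> t"
  shows "p = s * q * t / 2"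
proof -
  have "(p - p') * (p + p' - q * t\<^sup>2) = 0"
    using assms(2,3) by (simp add: algebra_simps power2_eq_square)
  moreover have "p + p' - q * t\<^sup>2 = (s - t) * (q * t)"
    unfolding assms(1) by (simp add: algebra_simps power2_eq_square)
  then have "p + p' - q * t\<^sup>2 \<noteq> 0"
    using assms(4-6) by simp
  ultimately have "p = p'"
    by simp
  then show ?thesis
    using assms(1) by simp
qed

lemma cell_norms:
  assumes "E8.cell_system W"
  shows "cmod (valA W l) = cA" "cmod (valB W l) = cB" "cmod (valC W l) = cC"
proof -
  have W: "E8.rotation_invariant W" "E8.type_I W" "E8.type_II W"
    using assms by (auto simp: E8.cell_system_def)
  note type_I = type_I_values[OF W(1,2)]
  have A: "(cmod (valA W l))\<^sup>2 = cA\<^sup>2" for l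
    unfolding type_I(1) power2_eq_square[of cA] cA_sq qnum_3 by simp
  have B: "(cmod (valB W l))\<^sup>2 = cB\<^sup>2" for l
  proof -
    have root: "((cmod (valB W l))\<^sup>2)\<^sup>2 + (qnum 2 * (qnum 3)\<^sup>2 - (cmod (valB W l))\<^sup>2)\<^sup>2
        = 2 * (qnum 3) ^ 4" for l
    proof -
      have "qnum 2 * (qnum 3)\<^sup>2 - (cmod (valB W l))\<^sup>2 = (cmod (valC W (l - 2)))\<^sup>2"
        using type_I(3)[of "l - 2"] by simp
      then show ?thesis
        using type_II_values(1)[OF W(1,3), of "l - 2"] by (simp add: power_mult[symmetric])
    qed
    have "(cmod (valB W l))\<^sup>2 + (cmod (valB W (l + 1)))\<^sup>2 = sqrt 2 * qnum 2 * qnum 3"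
      using type_I(2)[of l] unfolding type_I(1)
      by (simp add: qnum_3 algebra_simps power2_eq_square)
    from equal_roots[OF this root root]
    have "(cmod (valB W l))\<^sup>2 = sqrt 2 * qnum 2 * qnum 3 / 2"
      using qnum_2_pos qnum_3_pos by (simp add: qnum_3)
    then show ?thesis
      unfolding power2_eq_square[of cB] cB_sq by (simp add: qnum_3 algebra_simps)
  qed
  have C: "(cmod (valC W l))\<^sup>2 = cC\<^sup>2"
    using type_I(3)[of l]
    unfolding B power2_eq_square[of cC] power2_eq_square[of cB] cB_sq cC_sq
    by (simp add: qnum_3 field_simps power2_eq_square)
  show "cmod (valA W l) = cA" "cmod (valB W l) = cB" "cmod (valC W l) = cC"
    using A[of l] B[of l] C c_pos by (auto intro: power2_eq_imp_eq)
qed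

section \<open>The phases of an arbitrary cell system\<close>

text \<open>The phase of \<open>B l B (l + 2) B (l + 4) / C l\<close>, divided by its value for \<^const>\<open>cell_E8\<close>.\<close>

definition relative_phase where
  "relative_phase W l = valB W l * valB W (l + 2) * valB W (l + 4) * of_real (parity_sign l * cC)
     / (of_real (cB ^ 3) * valC W l)"

lemma norm_relative_phase:
  assumes "E8.cell_system W"
  shows "cmod (relative_phase W l) = 1"
  using c_pos
  by (simp add: relative_phase_def norm_mult norm_divide norm_power cell_norms[OF assms]
      power3_eq_cube parity_sign_def)

lemma clear_conjugates:
  fixes m :: "'a :: idom"
  assumes r: "b2 * b3' * c1 * b1' + c0 * b4' * b5 * b0' = 0"
    and b: "b3 * b3' = m" "b1 * b1' = m" "b4 * b4' = m" "b0 * b0' = m" and "m \<noteq> 0"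
  shows "b0 * b2 * b4 * c1 + b1 * b3 * b5 * c0 = 0"
proof -
  have "m * m * (b0 * b2 * b4 * c1) + m * m * (b1 * b3 * b5 * c0)
    = (b3 * b3') * (b1 * b1') * (b0 * b2 * b4 * c1) + (b4 * b4') * (b0 * b0') * (b1 * b3 * b5 * c0)"
    unfolding b ..
  also have "\<dots> = b0 * b1 * b3 * b4 * (b2 * b3' * c1 * b1' + c0 * b4' * b5 * b0')"
    by (simp add: algebra_simps)
  finally have "m * m * (b0 * b2 * b4 * c1 + b1 * b3 * b5 * c0) = 0"
    unfolding r by (simp add: algebra_simps)
  then show ?thesis
    using \<open>m \<noteq> 0\<close> by simp
qed

text \<open>Since the \<open>B l\<close> have the same modulus, the off-diagonal instance of (II) reads
  \<open>P l C (l + 1) + P (l + 1) C l = 0\<close> with \<open>P l = B l B (l + 2) B (l + 4)\<close>. The sign change in it is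
  the one of \<^const>\<open>parity_sign\<close>.\<close>

lemma relative_phase_step:
  assumes "E8.cell_system W"
  shows "relative_phase W (l + 1) = relative_phase W l"
proof -
  have W: "E8.rotation_invariant W" "E8.type_II W"
    using assms by (auto simp: E8.cell_system_def)
  note norms = cell_norms[OF assms]
  define P where "P l = valB W l * valB W (l + 2) * valB W (l + 4)" for l
  have nz: "valC W k \<noteq> 0" for k
    using norms(3)[of k] c_pos by auto
  have B: "valB W k * cnj (valB W k) = of_real (cB\<^sup>2)" for k
    by (simp only: norms(2)[of k, symmetric] complex_norm_square)
  have "P l * valC W (l + 1) + P (l + 1) * valC W l = 0"
    using clear_conjugates[OF type_II_values(2)[OF W, of l] B B B B] c_pos
    by (simp add: P_def index_normal_form mult_ac)
  then have "P (l + 1) * valC W l = - P l * valC W (l + 1)"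
    by (simp add: add_eq_0_iff)
  then have "P (l + 1) / valC W (l + 1) = - P l / valC W l"
    by (subst frac_eq_eq) (use nz in auto)
  moreover have "relative_phase W k
      = P k / valC W k * of_real (parity_sign k) * of_real (cC / cB ^ 3)" for k
    by (simp add: relative_phase_def P_def mult_ac)
  ultimately show ?thesis
    by (simp only: parity_sign_plus_1 of_real_minus) simp
qed

lemma relative_phase_const:
  assumes "E8.cell_system W"
  shows "relative_phase W l = relative_phase W 0"
proof -
  note step = relative_phase_step[OF assms]
  have "\<forall>l. relative_phase W l = relative_phase W 0"
    unfolding all_mod_6 using step[of 0] step[of 1] step[of 2] step[of 3] step[of 4] by simp
  then show ?thesis
    by blast
qed

section \<open>Uniqueness\<close>

lemma unit_root:
  assumes "cmod z = 1" and "n > 0"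
  obtains w where "cmod w = 1" "w ^ n = z"
proof
  have "z = cis (Arg z)"
    using assms(1) cis_Arg[of z] by (cases "z = 0") (auto simp: sgn_eq)
  then show "cis (Arg z / n) ^ n = z"
    using assms(2) by (simp add: Complex.DeMoivre)
qed simp

text \<open>The graph has no multiple edges, so the unitary matrices are numbers of modulus one.\<close>

lemma cell_equivalentI:
  assumes norm: "\<And>x y. adj x y \<Longrightarrow> cmod (g x y) = 1"
    and eq: "\<And>x y z. adj x y \<Longrightarrow> adj y z \<Longrightarrow> adj z x \<Longrightarrow>
       at_vertices W x y z = g x y * g y z * g z x * at_vertices W' x y z"
  shows "E8.cell_equivalent W W'"
  unfolding E8.cell_equivalent_def verts_E8 ball_arcs_from_to_E8
proof (intro exI[of _ "\<lambda>x y _ _. g x y"] conjI allI impI ballI)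
  fix x y
  assume "x \<rightarrow>\<^bsub>E8\<^esub> y"
  then have "adj x y"
    using arcs_E8 by (auto simp: E8_def arcs_ends_def arc_to_ends_def)
  then show "unitary_on (arcs_from_to E8 x y) (\<lambda>_ _. g x y)"
    using norm[of x y]
    by (simp add: unitary_on_def arcs_from_to_E8 complex_norm_square[symmetric] mult.commute)
next
  fix x y z
  assume "adj x y" "adj y z" "adj z x"
  then show "at_vertices W x y z
      = (\<Sum>\<sigma>'\<in>arcs_from_to E8 x y. \<Sum>\<rho>'\<in>arcs_from_to E8 y z. \<Sum>\<gamma>'\<in>arcs_from_to E8 z x.
          g x y * g y z * g z x * W' \<sigma>' \<rho>' \<gamma>')"
    using eq by (simp add: arcs_from_to_E8)
qed

text \<open>Every edge \<open>J l \<rightarrow> J (l - 1)\<close> gets the phase \<open>w\<close>. The edge \<open>I l \<rightarrow> J l\<close> occurs only in the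
  triangle of \<open>A l\<close>, and \<open>J (l - 2) \<rightarrow> J l\<close> in those of \<open>B l\<close> and \<open>C (l - 2)\<close>; their phases are
  chosen so that \<open>A l\<close> and \<open>B l\<close> come out right.\<close>

fun edge_phase where
  "edge_phase W w (I l) y = valA W l / (of_real cA * w)"
| "edge_phase W w (J l) (I m) = 1"
| "edge_phase W w (J l) (J m) = (if m = l + 2 then valB W m / (of_real cB * w\<^sup>2) else w)"

lemma cell_equivalent_cell_E8:
  assumes "E8.cell_system W"
  shows "E8.cell_equivalent W cell_E8"
proof -
  \<comment> \<open>With the above phases the triangle of \<open>C l\<close> acquires \<open>w\<close> to the power \<open>- 6\<close>, whence the sixth
    root.\<close>
  obtain w where w: "cmod w = 1" "w ^ 6 = relative_phase W 0"
    using unit_root[OF norm_relative_phase[OF assms], of 6 0] by auto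
  then have w0: "w \<noteq> 0"
    by auto
  note norms = cell_norms[OF assms]
  have rot: "E8.rotation_invariant W"
    using assms by (simp add: E8.cell_system_def)
  note rots = rotated_values[OF rot]
  have nz: "valB W k \<noteq> 0" "valC W k \<noteq> 0" for k
    using norms[of k] c_pos by auto
  let ?g = "edge_phase W w"
  have down: "?g (J k) (J (k - 1)) = w" for k
    using down_neq_up(1)[of k] by simp
  have up: "?g (J k) (J (k + 2)) = valB W (k + 2) / (of_real cB * w\<^sup>2)" for k
    by simp
  show ?thesis
  proof (rule cell_equivalentI[where g = ?g])
    show "cmod (?g x y) = 1" if "adj x y" for x y
      using that c_pos
      by (cases rule: adj_cases) (auto simp: w norms norm_divide norm_mult norm_power)
  next
    fix x y z
    assume "adj x y" "adj y z" "adj z x"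
    then show "at_vertices W x y z = ?g x y * ?g y z * ?g z x * at_vertices cell_E8 x y z"
    proof (induction rule: triangle_induct)
      case (rotate x y z)
      then show ?case
        using rot[unfolded rotation_invariant_E8, rule_format, of x y z]
          rotation_invariant_cell_E8[unfolded rotation_invariant_E8, rule_format, of x y z]
        by (simp add: mult_ac)
    next
      case (A l)
      show ?case
        using c_pos w0 unfolding rots down cell_E8_values by simp
    next
      case (B l)
      have "?g (J (l - 1)) (J (l - 2)) = w" "?g (J (l - 2)) (J l) = valB W l / (of_real cB * w\<^sup>2)"
        using down[of "l - 1"] up[of "l - 2"] by simp_all
      then show ?case
        using c_pos w0 unfolding rots down cell_E8_values
        by (simp only:) (simp add: power2_eq_square)
    next
      case (C l)
      have w6: "w ^ 6 = relative_phase W l"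
        using w relative_phase_const[OF assms, of l] by simp
      have valC: "valC W l = valB W l * valB W (l + 2) * valB W (l + 4) * of_real (parity_sign l * cC)
          / (of_real (cB ^ 3) * w ^ 6)"
        unfolding w6 relative_phase_def using nz c_pos by (simp add: parity_sign_def)
      have "l + 2 + 2 = l + 4" "l + 4 + 2 = l"
        by (simp_all add: index_normal_form)
      with up[of "l + 2"] up[of "l + 4"]
      have up': "?g (J (l + 2)) (J (l + 4)) = valB W (l + 4) / (of_real cB * w\<^sup>2)"
        "?g (J (l + 4)) (J l) = valB W l / (of_real cB * w\<^sup>2)"
        by simp_all
      have "(of_real cB * w\<^sup>2) * (of_real cB * w\<^sup>2) * (of_real cB * w\<^sup>2) = of_real (cB ^ 3) * w ^ 6"
        by (simp add: eval_nat_numeral)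
      then show ?case
        unfolding rots up up' cell_E8_values valC
        by (simp only: times_divide_eq_left times_divide_eq_right divide_divide_eq_left mult_ac)
    qed
  qed
qed

theorem theorem9p1:
  shows "\<exists>W. E8.cell_system W \<and>
    (\<forall>l. at_vertices W (I l) (J l) (J (l - 1)) = of_real (sqrt (qnum 2 * qnum 3))) \<and>
    (\<forall>l. at_vertices W (J l) (J (l - 1)) (J (l - 2))
           = of_real (qnum 2 * sqrt (qnum 3) / sqrt (qnum 4))) \<and>
    at_vertices W (J 1) (J 3) (J 5) = of_real (qnum 2 * qnum 3 / sqrt (qnum 4)) \<and>
    at_vertices W (J 2) (J 4) (J 6) = of_real (- (qnum 2 * qnum 3 / sqrt (qnum 4))) \<and>
    (\<forall>W'. E8.cell_system W' \<longrightarrow> E8.cell_equivalent W' W)"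
proof (intro exI[of _ cell_E8] conjI allI impI)
  show "at_vertices cell_E8 (J 1) (J 3) (J 5) = of_real (qnum 2 * qnum 3 / sqrt (qnum 4))"
    using cell_E8_values(3)[of 1] by (simp add: parity_sign_def cC_def)
  show "at_vertices cell_E8 (J 2) (J 4) (J 6) = of_real (- (qnum 2 * qnum 3 / sqrt (qnum 4)))"
    using cell_E8_values(3)[of 2] by (simp add: parity_sign_def cC_def)
qed (use cell_system_cell_E8 cell_equivalent_cell_E8 cell_E8_values(1,2) in
    \<open>simp_all only: cA_def cB_def\<close>)

end
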